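(* Consider the kinematic control system of the spherical rolling robot on the configuration space $Q=\mathbb{S}^1\times\mathbb{S}^1\times\mathsf{SO}(3)\times\mathbb{R}^2=\{(\varphi_1,\varphi_2,R,\mathbf{x})\}$ with control $u=(u_1,u_2)$: $$\dot\varphi_1=u_1,\qquad \dot\varphi_2=u_2,\qquad \dot R=\hat{\boldsymbol\omega}R,$$ $$\boldsymbol\omega=\begin{bmatrix} -\frac{\rho}{2h}\cos(c(\varphi_1-\varphi_2)) \\ -\frac{\rho}{2h}\sin(c(\varphi_1-\varphi_2)) \\ -cJ/I_{\rm s} \end{bmatrix}\dot\varphi_1+\begin{bmatrix} -\frac{\rho}{2h}\cos(c(\varphi_1-\varphi_2)) \\ -\frac{\rho}{2h}\sin(c(\varphi_1-\varphi_2)) \\ cJ/I_{\rm s} \end{bmatrix}\dot\varphi_2,$$ $$\dot{\mathbf{x}}=\frac{r\rho}{2h}(\dot\varphi_1+\dot\varphi_2)\begin{bmatrix} -\sin(c(\varphi_1-\varphi_2)) \\ \cos(c(\varphi_1-\varphi_2)) \end{bmatrix}.$$ This system is fiber controllable, i.e., given arbitrary two points $g_0,g_1\in\mathsf{G}=\mathsf{SO}(3)\times\mathbb{R}^2$, there exists a control $u\colon[t_0,t_1]\to\mathbb{R}^2$ such that the solution $g(t)=(R(t),\mathbf{x}(t))$ of the system under the initial condition $g(t_0)=g_0$ satisfies $g(t_1)=g_1$.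
   Context: The robot is a sphere rolling on a plane, driven by two internal wheels with rotation angles $\varphi=(\varphi_1,\varphi_2)$. The space $S=\mathbb{S}^1\times\mathbb{S}^1$ of wheel angles is called the shape space, and $\mathsf{G}=\mathsf{SO}(3)\times\mathbb{R}^2$ is the fiber, so $Q=S\times\mathsf{G}$; $R$ is the orientation of the sphere and $\mathbf{x}=(x_1,x_2)$ the horizontal position of its center. Fiber controllability concerns controllability in the direction of the fiber $\mathsf{G}$, regardless of the configurations of the wheels. The physical constants are: $r$ the radius of the sphere, $\rho$ the radius of the wheels, $2w$ the track width, $h$ the distance between the center of the sphere and the horizontal plane through the contact points of the wheels, $I_{\rm s}$ the moment of inertia of the sphere about an axis through its center, $J$ that of the internal electromechanical unit, and $c=\frac{\rho I_{\rm s}}{2w(I_{\rm s}+J)}$. For $\mathbf{a}=(a_1,a_2,a_3)\in\mathbb{R}^3$, the hat map gives $\hat{\mathbf{a}}=\begin{bmatrix} 0 & -a_3 & a_2 \\ a_3 & 0 & -a_1 \\ -a_2 & a_1 & 0 \end{bmatrix}\in\mathfrak{so}(3)$. *)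

theory Defs
  imports "HOL-Analysis.Analysis"
begin

definition hat :: "real^3 \<Rightarrow> real^3^3" where
  "hat a = vector [vector [0, - a$3, a$2],
                   vector [a$3, 0, - a$1],
                   vector [- a$2, a$1, 0]]"

definition fiber :: "((real^3^3) \<times> (real^2)) set" where
  "fiber = {R. rotation_matrix R} \<times> UNIV"

definition c_const :: "real \<Rightarrow> real \<Rightarrow> real \<Rightarrow> real \<Rightarrow> real" where
  "c_const \<rho> w Is J = \<rho> * Is / (2 * w * (Is + J))"

text \<open>
  For a non-integer c the function \<open>cos (c * (\<phi>1 - \<phi>2))\<close> does not descend to the torus of
  wheel angles.  The wheel configuration is therefore given by real angles, i.e. by a lift
  to the universal cover of the shape space; \<open>v\<close> stands for the angular velocity of the wheels.
\<close>

definition angular_velocity ::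
  "real \<Rightarrow> real \<Rightarrow> real \<Rightarrow> real \<Rightarrow> real \<Rightarrow> real^2 \<Rightarrow> real^2 \<Rightarrow> real^3" where
  "angular_velocity \<rho> w h Is J \<phi> v =
     (let c = c_const \<rho> w Is J; \<theta> = c * (\<phi>$1 - \<phi>$2) in
        v$1 *\<^sub>R vector [- (\<rho> / (2 * h)) * cos \<theta>, - (\<rho> / (2 * h)) * sin \<theta>, - (c * J / Is)]
      + v$2 *\<^sub>R vector [- (\<rho> / (2 * h)) * cos \<theta>, - (\<rho> / (2 * h)) * sin \<theta>, c * J / Is])"

definition center_velocity ::
  "real \<Rightarrow> real \<Rightarrow> real \<Rightarrow> real \<Rightarrow> real \<Rightarrow> real \<Rightarrow> real^2 \<Rightarrow> real^2 \<Rightarrow> real^2" where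
  "center_velocity r \<rho> w h Is J \<phi> v =
     (let \<theta> = c_const \<rho> w Is J * (\<phi>$1 - \<phi>$2) in
        (r * \<rho> / (2 * h) * (v$1 + v$2)) *\<^sub>R vector [- sin \<theta>, cos \<theta>])"

definition robot_trajectory ::
  "real \<Rightarrow> real \<Rightarrow> real \<Rightarrow> real \<Rightarrow> real \<Rightarrow> real \<Rightarrow> real \<Rightarrow> real \<Rightarrow> (real \<Rightarrow> real^2) \<Rightarrow>
   (real \<Rightarrow> real^2) \<Rightarrow> (real \<Rightarrow> real^3^3) \<Rightarrow> (real \<Rightarrow> real^2) \<Rightarrow> bool" where
  "robot_trajectory r \<rho> w h Is J t0 t1 u \<phi> R x \<longleftrightarrow>
     (\<forall>t\<in>{t0..t1}.
        (R t, x t) \<in> fiber \<and>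
        (\<phi> has_vector_derivative u t) (at t within {t0..t1}) \<and>
        (R has_vector_derivative hat (angular_velocity \<rho> w h Is J (\<phi> t) (u t)) ** R t)
          (at t within {t0..t1}) \<and>
        (x has_vector_derivative center_velocity r \<rho> w h Is J (\<phi> t) (u t))
          (at t within {t0..t1}))"

text \<open>
  The initial wheel angles are arbitrary and the final ones are unconstrained.  Controls are
  taken continuous, so that the equations hold at every time and the trajectory is determined
  by the control, the initial wheel angles and the initial point of the fiber.
\<close>

definition fiber_controllable ::
  "real \<Rightarrow> real \<Rightarrow> real \<Rightarrow> real \<Rightarrow> real \<Rightarrow> real \<Rightarrow> bool" where
  "fiber_controllable r \<rho> w h Is J \<longleftrightarrow>
     (\<forall>g0\<in>fiber. \<forall>g1\<in>fiber. \<forall>\<phi>0 t0 t1. t0 < t1 \<longrightarrow>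
        (\<exists>u \<phi> R x. continuous_on {t0..t1} u \<and>
           robot_trajectory r \<rho> w h Is J t0 t1 u \<phi> R x \<and>
           \<phi> t0 = \<phi>0 \<and> (R t0, x t0) = g0 \<and> (R t1, x t1) = g1))"

end

theory Submission
  imports Defs
begin

text \<open>
  With heading \<open>\<theta> = c (\<phi>1 - \<phi>2)\<close>, spinning the wheels oppositely changes \<open>\<theta>\<close> to \<open>\<theta>'\<close> and
  rotates the sphere about the vertical by \<open>- \<kappa> (\<theta>' - \<theta>)\<close>, \<open>\<kappa> = J / Is\<close>, with the center at rest;
  spinning them equally rolls the sphere along a straight line at constant heading.  By Euler
  angles a turn to a suitable heading (which exists because \<open>1 + \<kappa> \<noteq> 0\<close>) and one roll
  bring \<open>R\<close> to its target up to a rotation about the vertical.  Rolling by whole revolutions does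
  not change \<open>R\<close>, so two such stretches of equal length, in suitable directions, bring the
  center to its target.  All the turns involved contribute only a vertical rotation that
  depends on the total change of heading; since the final heading is free and \<open>\<kappa> \<noteq> 0\<close>, a last turn
  adjusts it.
\<close>

section \<open>Rotations about a unit axis: Rodrigues' formula for the exponential of
  \<open>\<beta> *\<^sub>R hat a\<close>\<close>

definition rodrigues :: "real^3 \<Rightarrow> real \<Rightarrow> real^3^3" where
  "rodrigues a \<beta> = mat 1 + sin \<beta> *\<^sub>R hat a + (1 - cos \<beta>) *\<^sub>R (hat a ** hat a)"

abbreviation rot_z :: "real \<Rightarrow> real^3^3" where
  "rot_z \<equiv> rodrigues (vector [0, 0, 1])"

abbreviation rot_x :: "real \<Rightarrow> real^3^3" where
  "rot_x \<equiv> rodrigues (vector [1, 0, 0])"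

abbreviation rolling_axis :: "real \<Rightarrow> real^3" where
  "rolling_axis \<theta> \<equiv> vector [cos \<theta>, sin \<theta>, 0]"

abbreviation rolling_direction :: "real \<Rightarrow> real^2" where
  "rolling_direction \<theta> \<equiv> vector [- sin \<theta>, cos \<theta>]"

lemmas mat3_simps = vec_eq_iff forall_3 sum_3 matrix_matrix_mult_def mat_def hat_def

interpretation matrix_mult: bounded_bilinear "(**) :: real^'n^'m \<Rightarrow> real^'k^'n \<Rightarrow> real^'k^'m"
  unfolding bilinear_conv_bounded_bilinear[symmetric] bilinear_def
  by (auto intro!: linearI simp: matrix_matrix_mult_def vec_eq_iff algebra_simps
      sum.distrib sum_distrib_left)

lemma hat_scaleR: "hat (k *\<^sub>R a) = k *\<^sub>R hat a"
  by (simp add: mat3_simps)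

text \<open>Cayley-Hamilton: the characteristic polynomial of \<open>hat a\<close> is X^3 + |a|^2
  X.\<close>

lemma hat_cube:
  assumes "norm a = 1"
  shows "hat a ** (hat a ** hat a) = - hat a"
proof -
  have n: "(a$1)\<^sup>2 + (a$2)\<^sup>2 + (a$3)\<^sup>2 = 1"
    using assms by (simp add: norm_eq_1 inner_vec_def sum_3 power2_eq_square)
  show ?thesis
    apply (simp add: mat3_simps)
    using n by algebra
qed

lemma rodrigues_0 [simp]: "rodrigues a 0 = mat 1"
  by (simp add: rodrigues_def)

lemma rodrigues_2pi_nat [simp]: "rodrigues a (- (2 * pi * real n)) = mat 1"
  using sin_2npi[of n] cos_2npi[of n] by (simp add: rodrigues_def mult_ac)

text \<open>Both factors are combinations of 1, K and K^2 for K = \<open>hat a\<close>. Reducing K^3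
  and K^4 by \<open>hat_cube\<close> leaves the addition formulas for \<open>sin\<close> and
  \<open>cos\<close> as coefficients.\<close>

lemma rodrigues_add:
  assumes "norm a = 1"
  shows "rodrigues a (\<beta> + \<gamma>) = rodrigues a \<beta> ** rodrigues a \<gamma>"
proof -
  let ?K = "hat a"
  have *: "?K ** ?K ** ?K = - ?K" "?K ** ?K ** (?K ** ?K) = - (?K ** ?K)"
    using hat_cube[OF assms] by (simp_all add: matrix_mul_assoc[symmetric] matrix_mult.minus_right)
  show ?thesis
    unfolding rodrigues_def sin_add cos_add
    by (simp add: matrix_mult.add_left matrix_mult.add_right matrix_mult.scaleR_left matrix_mult.scaleR_right
       matrix_mult.diff_left matrix_mult.diff_right
       hat_cube[OF assms] * algebra_simps)
qed

lemma transpose_rodrigues: "transpose (rodrigues a \<beta>) = rodrigues a (- \<beta>)"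
  by (simp add: rodrigues_def mat3_simps transpose_def)

lemma rotation_matrix_rodrigues:
  assumes "norm a = 1"
  shows "rotation_matrix (rodrigues a \<beta>)"
proof -
  have orth: "orthogonal_matrix (rodrigues a \<gamma>)" for \<gamma>
    unfolding orthogonal_matrix_def transpose_rodrigues
    by (simp flip: rodrigues_add[OF assms])
  \<comment> \<open>Being a square excludes the determinant -1.\<close>
  have "rodrigues a \<beta> = rodrigues a (\<beta>/2) ** rodrigues a (\<beta>/2)"
    by (simp flip: rodrigues_add[OF assms])
  hence "det (rodrigues a \<beta>) = det (rodrigues a (\<beta>/2)) * det (rodrigues a (\<beta>/2))"
    by (metis det_mul)
  with det_orthogonal_matrix[OF orth, of "\<beta>/2"] orth show ?thesis
    unfolding rotation_matrix_def by auto
qed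

lemma rotation_matrix_mult:
  "rotation_matrix (A :: real^'n^'n) \<Longrightarrow> rotation_matrix B \<Longrightarrow> rotation_matrix (A ** B)"
  by (simp add: rotation_matrix_def orthogonal_matrix_mul det_mul)

lemma rotation_matrix_transpose:
  "rotation_matrix (A :: real^'n^'n) \<Longrightarrow> rotation_matrix (transpose A)"
  by (simp add: rotation_matrix_def orthogonal_matrix_transpose)

text \<open>This is the orientation equation of the robot for the constant angular velocity
  \<open>k *\<^sub>R a\<close>; \<open>hat_cube\<close> turns the derivative of Rodrigues' formula
  into the product.\<close>

lemma rodrigues_has_vector_derivative:
  assumes "norm a = 1"
  shows "((\<lambda>s. rodrigues a (k * s) ** A) has_vector_derivative
           hat (k *\<^sub>R a) ** (rodrigues a (k * s) ** A)) (at s)"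
proof -
  have "((\<lambda>s. rodrigues a (k * s)) has_vector_derivative
          (k * cos (k * s)) *\<^sub>R hat a + (k * sin (k * s)) *\<^sub>R (hat a ** hat a)) (at s)"
    unfolding rodrigues_def
    by (rule derivative_eq_intros has_vector_derivative_scaleR refl | simp add: mult.commute)+
  moreover have "(k * cos (k * s)) *\<^sub>R hat a + (k * sin (k * s)) *\<^sub>R (hat a ** hat a)
      = hat (k *\<^sub>R a) ** rodrigues a (k * s)"
    using hat_cube[OF assms]
    by (simp add: rodrigues_def hat_scaleR matrix_mult.add_right matrix_mult.diff_right matrix_mult.scaleR_right
        matrix_mult.scaleR_left algebra_simps)
  ultimately show ?thesis
    using bounded_linear.has_vector_derivative[OF matrix_mult.bounded_linear_left]
    by (fastforce simp: matrix_mul_assoc)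
qed

section \<open>Rolling axes and Euler angles\<close>

lemma norm_rolling_axis [simp]: "norm (rolling_axis \<theta>) = 1"
  by (simp add: norm_eq_1 inner_vec_def sum_3 flip: power2_eq_square)

lemma norm_coordinate_axes [simp]:
  "norm (vector [1, 0, 0] :: real^3) = 1" "norm (vector [0, 0, 1] :: real^3) = 1"
  by (simp_all add: norm_eq_1 inner_vec_def sum_3)

text \<open>The rolling axis is the image of the first coordinate axis under
  \<open>rot_z \<theta>\<close>, so the two rotations are conjugate.\<close>

lemma rodrigues_rolling_axis:
  "rodrigues (rolling_axis \<theta>) \<beta> = rot_z \<theta> ** rot_x \<beta> ** rot_z (- \<theta>)"
  apply (simp add: mat3_simps rodrigues_def)
  using sin_cos_squared_add[of \<theta>] by algebra

lemma rotation_fixing_vertical_axis: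
  assumes "rotation_matrix M" "M *v vector [0, 0, 1] = vector [0, 0, 1]"
  obtains \<gamma> where "M = rot_z \<gamma>"
proof -
  have c: "M$1$3 = 0" "M$2$3 = 0" "M$3$3 = 1"
    using assms(2) by (simp_all add: vec_eq_iff forall_3 matrix_vector_mult_def sum_3)
  have o: "transpose M ** M = mat 1" "M ** transpose M = mat 1" and d: "det M = 1"
    using assms(1) by (simp_all add: rotation_matrix_def orthogonal_matrix_def)
  \<comment> \<open>The third row is a unit vector whose last entry is already 1.\<close>
  from o(2) have "(M$3$1)\<^sup>2 + (M$3$2)\<^sup>2 = 0"
    by (simp add: mat3_simps transpose_def c power2_eq_square)
  hence r: "M$3$1 = 0" "M$3$2 = 0"
    by (simp_all add: sum_power2_eq_zero_iff)
  have n: "(M$1$1)\<^sup>2 + (M$2$1)\<^sup>2 = 1" and p: "M$1$1 * M$1$2 + M$2$1 * M$2$2 = 0"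
    using o(1) by (simp_all add: mat3_simps transpose_def c r power2_eq_square)
  have q: "M$1$1 * M$2$2 - M$1$2 * M$2$1 = 1"
    using d by (simp add: det_3 c r)
  from n obtain \<gamma> where \<gamma>: "M$1$1 = cos \<gamma>" "M$2$1 = sin \<gamma>"
    by (rule sincos_total_2pi)
  \<comment> \<open>By \<open>p\<close> and \<open>q\<close> the rest of the second column solves a
    linear system with determinant 1 by \<open>n\<close>.\<close>
  have "M$1$2 = - M$2$1" "M$2$2 = M$1$1"
    using n p q by algebra+
  hence "M = rot_z \<gamma>"
    by (simp add: mat3_simps rodrigues_def c r \<gamma>)
  thus ?thesis by (rule that)
qed

text \<open>Spherical coordinates: \<open>rot_x \<beta>\<close> tilts the vertical axis by the polar
  angle, \<open>rot_z \<alpha>\<close> then sets the azimuth.\<close>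

lemma unit_vector_spherical:
  fixes v :: "real^3"
  assumes "norm v = 1"
  obtains \<alpha> \<beta> where "v = rot_z \<alpha> ** rot_x \<beta> *v vector [0, 0, 1]"
proof -
  have n: "(v$1)\<^sup>2 + (v$2)\<^sup>2 + (v$3)\<^sup>2 = 1"
    using assms by (simp add: norm_eq_1 inner_vec_def sum_3 power2_eq_square)
  define s where "s = sqrt ((v$1)\<^sup>2 + (v$2)\<^sup>2)"
  have s: "s\<^sup>2 = (v$1)\<^sup>2 + (v$2)\<^sup>2" by (simp add: s_def)
  have "(v$3)\<^sup>2 + s\<^sup>2 = 1" using n s by simp
  then obtain \<beta> where \<beta>: "v$3 = cos \<beta>" "s = sin \<beta>" by (rule sincos_total_2pi)
  \<comment> \<open>At the poles, where \<open>s = 0\<close>, every azimuth works.\<close>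
  obtain \<alpha> where \<alpha>: "v$1 = s * sin \<alpha>" "v$2 = - s * cos \<alpha>"
  proof (cases "s = 0")
    case True
    with s have "v$1 = 0" "v$2 = 0" by (simp_all add: sum_power2_eq_zero_iff)
    with True that show ?thesis by simp
  next
    case False
    have "(- v$2 / s)\<^sup>2 + (v$1 / s)\<^sup>2 = s\<^sup>2 / s\<^sup>2"
      by (simp only: power_divide power2_minus s)
         (simp only: add.commute flip: add_divide_distrib)
    also have "\<dots> = 1" using False by simp
    finally have "(- v$2 / s)\<^sup>2 + (v$1 / s)\<^sup>2 = 1" .
    then obtain \<alpha> where "- v$2 / s = cos \<alpha>" "v$1 / s = sin \<alpha>" by (rule sincos_total_2pi)
    with False show ?thesis by (intro that[of \<alpha>]) (simp_all add: field_simps)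
  qed
  show ?thesis
    by (rule that[of \<alpha> \<beta>])
       (simp add: mat3_simps rodrigues_def matrix_vector_mult_def \<alpha> \<beta>)
qed

text \<open>Once \<open>N = rot_z \<alpha> ** rot_x \<beta>\<close> agrees with \<open>T\<close> on
  the vertical axis, \<open>transpose N ** T\<close> fixes that axis and is a rotation about
  it.\<close>

lemma euler_angles:
  assumes "rotation_matrix T"
  obtains \<alpha> \<beta> \<gamma> where "T = rot_z \<alpha> ** rot_x \<beta> ** rot_z \<gamma>"
proof -
  have "norm (T *v vector [0, 0, 1]) = 1"
    using assms orthogonal_transformation_matrix[of "(*v) T"]
    by (simp add: rotation_matrix_def orthogonal_transformation)
  then obtain \<alpha> \<beta> where ab:
    "T *v vector [0, 0, 1] = rot_z \<alpha> ** rot_x \<beta> *v vector [0, 0, 1]"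
    by (rule unit_vector_spherical)
  define N where "N = rot_z \<alpha> ** rot_x \<beta>"
  have N: "rotation_matrix N"
    by (simp add: N_def rotation_matrix_mult rotation_matrix_rodrigues)
  hence o: "transpose N ** N = mat 1" "N ** transpose N = mat 1"
    by (simp_all add: rotation_matrix_def orthogonal_matrix_def)
  have "transpose N ** T *v vector [0, 0, 1] = vector [0, 0, 1]"
    using ab o(1) by (metis N_def matrix_vector_mul_assoc matrix_vector_mul_lid)
  moreover have "rotation_matrix (transpose N ** T)"
    using N assms by (simp add: rotation_matrix_mult rotation_matrix_transpose)
  ultimately obtain \<gamma> where "transpose N ** T = rot_z \<gamma>"
    by (metis rotation_fixing_vertical_axis)
  hence "T = N ** rot_z \<gamma>"
    using o by (metis matrix_mul_assoc matrix_mul_lid)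
  with N_def show ?thesis by (intro that) simp
qed

section \<open>Concatenation of trajectories and homogeneity of the velocities\<close>

lemma robot_trajectory_join:
  assumes "t0 < m" "m < t1"
    and 1: "robot_trajectory r \<rho> w h Is J t0 m u1 \<phi>1 R1 x1"
    and 2: "robot_trajectory r \<rho> w h Is J m t1 u2 \<phi>2 R2 x2"
    and match: "u1 m = u2 m" "\<phi>1 m = \<phi>2 m" "R1 m = R2 m" "x1 m = x2 m"
  shows "robot_trajectory r \<rho> w h Is J t0 t1
    (\<lambda>t. if t \<in> {t0..m} then u1 t else u2 t) (\<lambda>t. if t \<in> {t0..m} then \<phi>1 t else \<phi>2 t)
    (\<lambda>t. if t \<in> {t0..m} then R1 t else R2 t) (\<lambda>t. if t \<in> {t0..m} then x1 t else x2 t)"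
proof -
  \<comment> \<open>The condition \<open>f' m = g' m\<close> makes the one-sided derivatives at
    \<open>m\<close> agree. It is supplied by \<open>match\<close>, which includes equality of the
    two controls at \<open>m\<close>.\<close>
  have join: "((\<lambda>t. if t \<in> {t0..m} then f t else g t) has_vector_derivative
                 (if t \<in> {t0..m} then f' t else g' t)) (at t within {t0..t1})"
    if "t \<in> {t0..t1}" "f m = g m" "f' m = g' m"
      "\<forall>t\<in>{t0..m}. (f has_vector_derivative f' t) (at t within {t0..m})"
      "\<forall>t\<in>{m..t1}. (g has_vector_derivative g' t) (at t within {m..t1})"
    for f g f' g' :: "real \<Rightarrow> 'z::real_normed_vector" and t
  proof -
    have "t \<in> {t0..m} \<union> {m..t1}" "{t0..t1} = {t0..m} \<union> {m..t1}"
      and i: "{t0..m} \<inter> {m..t1} = {m}"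
      using that assms by auto
    moreover have "{t0..m} \<union> {m} = {t0..m}" "{m..t1} \<union> {m} = {m..t1}"
      using assms by auto
    moreover have "t = m" if "t \<in> {t0..m}" "t \<in> {m..t1}"
      using that by auto
    ultimately show ?thesis using that
      by (intro has_vector_derivative_If_within_closures) (auto simp: i)
  qed
  let ?\<omega> = "angular_velocity \<rho> w h Is J" and ?y = "center_velocity r \<rho> w h Is J"
  show ?thesis
    unfolding robot_trajectory_def
  proof (intro ballI conjI)
    fix t assume t: "t \<in> {t0..t1}"
    show "(if t \<in> {t0..m} then R1 t else R2 t, if t \<in> {t0..m} then x1 t else x2 t) \<in> fiber"
      using t 1 2 by (auto simp: robot_trajectory_def)
    show "((\<lambda>t. if t \<in> {t0..m} then \<phi>1 t else \<phi>2 t) has_vector_derivative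
            (if t \<in> {t0..m} then u1 t else u2 t)) (at t within {t0..t1})"
      using t 1 2 match by (intro join) (auto simp: robot_trajectory_def)
    have "((\<lambda>t. if t \<in> {t0..m} then R1 t else R2 t) has_vector_derivative
       (if t \<in> {t0..m} then hat (?\<omega> (\<phi>1 t) (u1 t)) ** R1 t else hat (?\<omega> (\<phi>2 t) (u2 t)) ** R2 t))
       (at t within {t0..t1})"
      using t 1 2 match by (intro join) (auto simp: robot_trajectory_def)
    thus "((\<lambda>t. if t \<in> {t0..m} then R1 t else R2 t) has_vector_derivative
       hat (?\<omega> (if t \<in> {t0..m} then \<phi>1 t else \<phi>2 t) (if t \<in> {t0..m} then u1 t else u2 t))
         ** (if t \<in> {t0..m} then R1 t else R2 t)) (at t within {t0..t1})"
      by (cases "t \<in> {t0..m}") (simp_all only: if_True if_False)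
    have "((\<lambda>t. if t \<in> {t0..m} then x1 t else x2 t) has_vector_derivative
       (if t \<in> {t0..m} then ?y (\<phi>1 t) (u1 t) else ?y (\<phi>2 t) (u2 t))) (at t within {t0..t1})"
      using t 1 2 match by (intro join) (auto simp: robot_trajectory_def)
    thus "((\<lambda>t. if t \<in> {t0..m} then x1 t else x2 t) has_vector_derivative
       ?y (if t \<in> {t0..m} then \<phi>1 t else \<phi>2 t) (if t \<in> {t0..m} then u1 t else u2 t))
       (at t within {t0..t1})"
      by (cases "t \<in> {t0..m}") (simp_all only: if_True if_False)
  qed
qed

lemma angular_velocity_scaleR:
  "angular_velocity \<rho> w h Is J \<phi> (k *\<^sub>R v) = k *\<^sub>R angular_velocity \<rho> w h Is J \<phi> v"
  by (simp add: angular_velocity_def Let_def scaleR_add_right)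

lemma center_velocity_scaleR:
  "center_velocity r \<rho> w h Is J \<phi> (k *\<^sub>R v) = k *\<^sub>R center_velocity r \<rho> w h Is J \<phi> v"
  by (simp add: center_velocity_def Let_def mult_ac flip: distrib_left)

text \<open>An isosceles triangle with base \<open>v\<close>: legs of length
  \<open>k * real n\<close>, deviating by \<eta> to either side of the direction of
  \<open>v\<close>, sum to \<open>v\<close> if \<open>cos \<eta>\<close> is chosen to fit.\<close>

lemma plane_vector_equal_multiples_of_directions:
  fixes v :: "real^2" and k :: real
  assumes "k > 0"
  obtains n \<theta> \<theta>' where
    "v = (k * real n) *\<^sub>R rolling_direction \<theta> + (k * real n) *\<^sub>R rolling_direction \<theta>'"
proof -
  define l where "l = norm v"
  have l2: "l\<^sup>2 = (v$1)\<^sup>2 + (v$2)\<^sup>2"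
    unfolding l_def power2_norm_eq_inner by (simp add: inner_vec_def sum_2 power2_eq_square)
  obtain \<alpha> where \<alpha>: "v$1 = - l * sin \<alpha>" "v$2 = l * cos \<alpha>"
  proof (cases "l = 0")
    case True
    with that show ?thesis by (simp add: l_def)
  next
    case False
    have "(v$2 / l)\<^sup>2 + (- v$1 / l)\<^sup>2 = l\<^sup>2 / l\<^sup>2"
      by (simp only: power_divide power2_minus l2) (simp only: add.commute flip: add_divide_distrib)
    also have "\<dots> = 1" using False by simp
    finally obtain \<alpha> where "v$2 / l = cos \<alpha>" "- v$1 / l = sin \<alpha>" by (rule sincos_total_2pi)
    with False show ?thesis by (intro that[of \<alpha>]) (simp_all add: field_simps)
  qed
  \<comment> \<open>The legs must be long enough to span the base, so that the argument of
    \<open>arccos\<close> is at most 1. The strict inequality makes \<open>n\<close> positive even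
    for \<open>v = 0\<close>.\<close>
  obtain n :: nat where n: "l / (2 * k) < real n"
    using reals_Archimedean2 by blast
  have l0: "l \<ge> 0" by (simp add: l_def)
  with assms n have n0: "real n > 0"
    by (smt (verit) divide_nonneg_nonneg)
  define \<eta> where "\<eta> = arccos (l / (2 * k * real n))"
  have "cos \<eta> = l / (2 * k * real n)"
    unfolding \<eta>_def using assms n n0 l0
    by (intro cos_arccos) (auto simp: field_simps intro: order_trans[of _ 0])
  hence "l = 2 * k * real n * cos \<eta>"
    using assms n0 by simp
  hence "v = (k * real n) *\<^sub>R rolling_direction (\<alpha> + \<eta>)
      + (k * real n) *\<^sub>R rolling_direction (\<alpha> - \<eta>)"
    by (simp add: vec_eq_iff forall_2 \<alpha> sin_add sin_diff cos_add cos_diff algebra_simps)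
  thus ?thesis by (rule that)
qed

section \<open>Steering between states given by heading, orientation and center\<close>

locale rolling_robot =
  fixes r \<rho> w h Is J :: real
  assumes pos: "r > 0" "\<rho> > 0" "w > 0" "h > 0" "Is > 0" "J > 0"
begin

abbreviation c where "c \<equiv> c_const \<rho> w Is J"

definition heading :: "real^2 \<Rightarrow> real" where
  "heading \<phi> = c * (\<phi>$1 - \<phi>$2)"

text \<open>Controls that vanish at both ends of the time interval can be concatenated continuously.\<close>

definition steerable ::
  "real \<Rightarrow> real^3^3 \<Rightarrow> real^2 \<Rightarrow> real \<Rightarrow> real^3^3 \<Rightarrow> real^2 \<Rightarrow> bool" where
  "steerable \<theta>0 R0 x0 \<theta>1 R1 x1 \<longleftrightarrow>
     (\<forall>\<phi>0 t0 t1. heading \<phi>0 = \<theta>0 \<longrightarrow> t0 < t1 \<longrightarrow>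
        (\<exists>u \<phi> R x. continuous_on {t0..t1} u \<and> u t0 = 0 \<and> u t1 = 0 \<and>
           robot_trajectory r \<rho> w h Is J t0 t1 u \<phi> R x \<and>
           \<phi> t0 = \<phi>0 \<and> R t0 = R0 \<and> x t0 = x0 \<and>
           heading (\<phi> t1) = \<theta>1 \<and> R t1 = R1 \<and> x t1 = x1))"

lemma steerable_trans [trans]:
  assumes "steerable \<theta>0 R0 x0 \<theta>1 R1 x1" "steerable \<theta>1 R1 x1 \<theta>2 R2 x2"
  shows "steerable \<theta>0 R0 x0 \<theta>2 R2 x2"
  unfolding steerable_def
proof (intro allI impI)
  fix \<phi>0 :: "real^2" and t0 t1 :: real
  assume \<phi>0: "heading \<phi>0 = \<theta>0" and t: "t0 < t1"
  define m where "m = (t0 + t1) / 2"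
  have m: "t0 < m" "m < t1" using t by (auto simp: m_def)
  obtain u1 \<phi>1 T1 y1 where 1: "continuous_on {t0..m} u1" "u1 t0 = 0" "u1 m = 0"
      "robot_trajectory r \<rho> w h Is J t0 m u1 \<phi>1 T1 y1" "\<phi>1 t0 = \<phi>0" "T1 t0 = R0" "y1 t0 = x0"
      "heading (\<phi>1 m) = \<theta>1" "T1 m = R1" "y1 m = x1"
    using assms(1)[unfolded steerable_def, rule_format, OF \<phi>0 m(1)] by blast
  \<comment> \<open>The second motion starts from the wheel angles that the first one reaches;
    \<open>steerable\<close> covers them all, as it fixes only their heading.\<close>
  obtain u2 \<phi>2 T2 y2 where 2: "continuous_on {m..t1} u2" "u2 m = 0" "u2 t1 = 0"
      "robot_trajectory r \<rho> w h Is J m t1 u2 \<phi>2 T2 y2" "\<phi>2 m = \<phi>1 m" "T2 m = R1" "y2 m = x1"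
      "heading (\<phi>2 t1) = \<theta>2" "T2 t1 = R2" "y2 t1 = x2"
    using assms(2)[unfolded steerable_def, rule_format, OF 1(8) m(2)] by blast
  let ?j = "\<lambda>f g t. if t \<in> {t0..m} then f t else g t"
  have "continuous_on ({t0..m} \<union> {m..t1}) (?j u1 u2)"
  proof (rule continuous_on_If)
    fix t assume "t \<in> {m..t1}" "t \<in> {t0..m}"
    hence "t = m" by auto
    thus "u1 t = u2 t" using 1 2 by simp
  qed (use 1 2 in auto)
  moreover have "{t0..m} \<union> {m..t1} = {t0..t1}" using m by auto
  moreover have "robot_trajectory r \<rho> w h Is J t0 t1 (?j u1 u2) (?j \<phi>1 \<phi>2) (?j T1 T2) (?j y1 y2)"
    using m 1 2 by (intro robot_trajectory_join) auto
  ultimately show "\<exists>u \<phi> R x. continuous_on {t0..t1} u \<and> u t0 = 0 \<and> u t1 = 0 \<and>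
           robot_trajectory r \<rho> w h Is J t0 t1 u \<phi> R x \<and>
           \<phi> t0 = \<phi>0 \<and> R t0 = R0 \<and> x t0 = x0 \<and>
           heading (\<phi> t1) = \<theta>2 \<and> R t1 = R2 \<and> x t1 = x2"
    using m 1 2
    by (intro exI[of _ "?j u1 u2"] exI[of _ "?j \<phi>1 \<phi>2"] exI[of _ "?j T1 T2"] exI[of _ "?j y1 y2"]) auto
qed

text \<open>The wheel angles move along a segment with the smoothstep profile \<open>3\<tau>\<^sup>2 - 2\<tau>\<^sup>3\<close>, which is
  at rest at both ends.\<close>

lemma steerable_segment:
  assumes R0: "rotation_matrix R0" and a: "norm a = 1"
    and \<omega>: "\<And>\<phi>0 s. heading \<phi>0 = \<theta> \<Longrightarrow> angular_velocity \<rho> w h Is J (\<phi>0 + s *\<^sub>R p) p = k *\<^sub>R a"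
    and v: "\<And>\<phi>0 s. heading \<phi>0 = \<theta> \<Longrightarrow> center_velocity r \<rho> w h Is J (\<phi>0 + s *\<^sub>R p) p = y"
  shows "steerable \<theta> R0 x0 (\<theta> + heading p) (rodrigues a k ** R0) (x0 + y)"
  unfolding steerable_def
proof (intro allI impI)
  fix \<phi>0 :: "real^2" and t0 t1 :: real
  assume \<phi>0: "heading \<phi>0 = \<theta>" and t: "t0 < t1"
  define e where "e = 1 / (t1 - t0)"
  define \<tau> where "\<tau> t = (t - t0) * e" for t
  define s where "s t = 3 * (\<tau> t)\<^sup>2 - 2 * (\<tau> t)^3" for t
  define s' where "s' t = 6 * \<tau> t * (1 - \<tau> t) * e" for t
  define u where "u t = s' t *\<^sub>R p" for t
  have \<tau>: "\<tau> t0 = 0" "\<tau> t1 = 1" using t by (simp_all add: \<tau>_def e_def)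
  have s: "s t0 = 0" "s t1 = 1" by (simp_all add: s_def \<tau>)
  have \<tau>': "(\<tau> has_real_derivative e) (at t within A)" for t A
    unfolding \<tau>_def by (auto intro!: derivative_eq_intros)
  have ds: "(s has_real_derivative s' t) (at t within A)" for t A
    unfolding s_def s'_def
    by (rule derivative_eq_intros \<tau>' refl)+ (simp add: algebra_simps power2_eq_square)
  note ds' = ds[unfolded has_real_derivative_iff_has_vector_derivative]
  have "continuous_on {t0..t1} u"
    unfolding u_def s'_def \<tau>_def by (intro continuous_intros)
  moreover have "u t0 = 0" "u t1 = 0"
    by (simp_all add: u_def s'_def \<tau>)
  \<comment> \<open>By \<open>\<omega>\<close> and \<open>v\<close> the velocities are constant
    along the segment, so in the parameter \<open>s\<close> the sphere spins uniformly about
    \<open>a\<close> and its center moves uniformly. Passing to time multiplies all velocities by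
    \<open>s'\<close>.\<close>
  moreover have "robot_trajectory r \<rho> w h Is J t0 t1 u (\<lambda>t. \<phi>0 + s t *\<^sub>R p)
      (\<lambda>t. rodrigues a (k * s t) ** R0) (\<lambda>t. x0 + s t *\<^sub>R y)"
    unfolding robot_trajectory_def
  proof (intro ballI conjI)
    fix t
    show "(rodrigues a (k * s t) ** R0, x0 + s t *\<^sub>R y) \<in> fiber"
      by (simp add: fiber_def rotation_matrix_mult rotation_matrix_rodrigues a R0)
    show "((\<lambda>t. \<phi>0 + s t *\<^sub>R p) has_vector_derivative u t) (at t within {t0..t1})"
      unfolding u_def by (auto intro!: derivative_eq_intros ds)
    show "((\<lambda>t. x0 + s t *\<^sub>R y) has_vector_derivative
        center_velocity r \<rho> w h Is J (\<phi>0 + s t *\<^sub>R p) (u t)) (at t within {t0..t1})"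
      unfolding u_def center_velocity_scaleR v[OF \<phi>0] by (auto intro!: derivative_eq_intros ds)
    have "(((\<lambda>s. rodrigues a (k * s) ** R0) \<circ> s) has_vector_derivative
        s' t *\<^sub>R (hat (k *\<^sub>R a) ** (rodrigues a (k * s t) ** R0))) (at t within {t0..t1})"
      by (rule vector_diff_chain_within[OF ds' has_vector_derivative_at_within])
         (rule rodrigues_has_vector_derivative[OF a])
    thus "((\<lambda>t. rodrigues a (k * s t) ** R0) has_vector_derivative
        hat (angular_velocity \<rho> w h Is J (\<phi>0 + s t *\<^sub>R p) (u t)) ** (rodrigues a (k * s t) ** R0))
        (at t within {t0..t1})"
      unfolding u_def angular_velocity_scaleR \<omega>[OF \<phi>0] hat_scaleR[of "s' t"]
      by (simp add: o_def matrix_mult.scaleR_left)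
  qed
  moreover have "heading (\<phi>0 + p) = \<theta> + heading p"
    using \<phi>0 by (simp add: heading_def algebra_simps)
  ultimately show "\<exists>u \<phi> R x. continuous_on {t0..t1} u \<and> u t0 = 0 \<and> u t1 = 0 \<and>
           robot_trajectory r \<rho> w h Is J t0 t1 u \<phi> R x \<and>
           \<phi> t0 = \<phi>0 \<and> R t0 = R0 \<and> x t0 = x0 \<and>
           heading (\<phi> t1) = \<theta> + heading p \<and> R t1 = rodrigues a k ** R0 \<and> x t1 = x0 + y"
    by (intro exI[of _ u] exI[of _ "\<lambda>t. \<phi>0 + s t *\<^sub>R p"]
        exI[of _ "\<lambda>t. rodrigues a (k * s t) ** R0"] exI[of _ "\<lambda>t. x0 + s t *\<^sub>R y"])
       (simp add: s)
qed

section \<open>Elementary maneuvers: turns and rolls\<close>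

lemma c_pos: "c > 0"
  using pos by (simp add: c_const_def)

lemma steerable_turn:
  assumes "rotation_matrix R"
  shows "steerable \<theta> R x \<theta>' (rot_z (- (J / Is * (\<theta>' - \<theta>))) ** R) x"
proof -
  \<comment> \<open>Opposite rates cancel the center velocity and the horizontal part of the angular
    velocity at every heading. The factor is chosen because the heading of (1, -1) is
    \<open>2 * c\<close>.\<close>
  define p :: "real^2" where "p = ((\<theta>' - \<theta>) / (2 * c)) *\<^sub>R vector [1, -1]"
  have p: "p$1 = (\<theta>' - \<theta>) / (2 * c)" "p$2 = - ((\<theta>' - \<theta>) / (2 * c))"
    by (simp_all add: p_def)
  have "steerable \<theta> R x (\<theta> + heading p) (rot_z (- (J / Is * (\<theta>' - \<theta>))) ** R) (x + 0)"
    using assms c_pos pos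
    by (intro steerable_segment)
       (auto simp: angular_velocity_def center_velocity_def Let_def p
         vec_eq_iff forall_3 forall_2 field_simps)
  moreover have "heading p = \<theta>' - \<theta>"
    using c_pos by (simp add: heading_def p field_simps)
  ultimately show ?thesis by simp
qed

lemma steerable_roll:
  assumes "rotation_matrix R"
  shows "steerable \<theta> R x \<theta> (rodrigues (rolling_axis \<theta>) (- d) ** R)
           (x + (r * d) *\<^sub>R rolling_direction \<theta>)"
proof -
  \<comment> \<open>The amount \<open>d * h / \<rho>\<close> per wheel makes the sphere roll through
    the angle \<open>d\<close>, hence its center travel \<open>r * d\<close>.\<close>
  define p :: "real^2" where "p = (d * h / \<rho>) *\<^sub>R vector [1, 1]"
  have p: "p$1 = d * h / \<rho>" "p$2 = d * h / \<rho>"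
    by (simp_all add: p_def)
  have hd: "c * (\<phi>$1 + s * p$1 - (\<phi>$2 + s * p$2)) = \<theta>" if "heading \<phi> = \<theta>" for \<phi> s
    using that by (simp add: heading_def p)
  have "steerable \<theta> R x (\<theta> + heading p) (rodrigues (rolling_axis \<theta>) (- d) ** R)
          (x + (r * d) *\<^sub>R rolling_direction \<theta>)"
    using assms pos
    by (intro steerable_segment)
       (simp_all add: angular_velocity_def center_velocity_def Let_def hd,
        simp_all add: p vec_eq_iff forall_3 forall_2 field_simps)
  thus ?thesis by (simp add: heading_def p)
qed

lemma steerable_full_rolls:
  assumes "rotation_matrix R"
  shows "steerable \<theta> R x \<theta> R (x + (2 * pi * r * real n) *\<^sub>R rolling_direction \<theta>)"
  using steerable_roll[OF assms, of \<theta> x "2 * pi * real n"]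
  by (simp only: rodrigues_2pi_nat matrix_mul_lid) (simp add: mult_ac)

lemma steerable_turn_translate:
  assumes R: "rotation_matrix R"
  obtains \<theta>' where "steerable \<theta> R x \<theta>' (rot_z \<beta> ** R) y"
proof -
  have "2 * pi * r > 0" using pos by simp
  then obtain n \<alpha>1 \<alpha>2 where y: "y - x = (2 * pi * r * real n) *\<^sub>R rolling_direction \<alpha>1
      + (2 * pi * r * real n) *\<^sub>R rolling_direction \<alpha>2"
    by (rule plane_vector_equal_multiples_of_directions)
  \<comment> \<open>\<open>?z\<close> is the orientation after turning to a given heading. Turns
    compose additively and whole revolutions change nothing, so it stays valid at the end of each
    stretch.\<close>
  let ?z = "\<lambda>\<theta>'. rot_z (- (J / Is * (\<theta>' - \<theta>))) ** R"
  \<comment> \<open>The final heading for which the accumulated vertical rotation equals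
    \<beta>.\<close>
  let ?\<theta>' = "\<theta> - Is / J * \<beta>"
  let ?x = "x + (2 * pi * r * real n) *\<^sub>R rolling_direction \<alpha>1"
  have z: "rotation_matrix (?z \<theta>')" for \<theta>'
    by (simp add: rotation_matrix_mult rotation_matrix_rodrigues R)
  have turn: "steerable \<theta>1 (?z \<theta>1) x' \<theta>2 (?z \<theta>2) x'" for \<theta>1 \<theta>2 x'
    using steerable_turn[OF z, of \<theta>1 \<theta>1 x' \<theta>2]
    by (simp add: matrix_mul_assoc algebra_simps diff_divide_distrib flip: rodrigues_add)
  have "steerable \<theta> R x \<alpha>1 (?z \<alpha>1) x"
    using steerable_turn[OF R] .
  also have "steerable \<alpha>1 (?z \<alpha>1) x \<alpha>1 (?z \<alpha>1) ?x"
    using steerable_full_rolls[OF z] .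
  also have "steerable \<alpha>1 (?z \<alpha>1) ?x \<alpha>2 (?z \<alpha>2) ?x"
    using turn .
  also have "steerable \<alpha>2 (?z \<alpha>2) ?x \<alpha>2 (?z \<alpha>2) y"
    using steerable_full_rolls[OF z, of \<alpha>2 \<alpha>2 ?x n] y by (simp add: algebra_simps)
  also have "steerable \<alpha>2 (?z \<alpha>2) y ?\<theta>' (?z ?\<theta>') y"
    using turn .
  also have "?z ?\<theta>' = rot_z \<beta> ** R"
    using pos by simp
  finally show ?thesis by (rule that)
qed

lemma steerable_fiber:
  assumes R0: "rotation_matrix R0" and R1: "rotation_matrix R1"
  obtains \<theta>' where "steerable \<theta> R0 x \<theta>' R1 y"
proof -
  let ?\<kappa> = "J / Is"
  have "rotation_matrix (R1 ** transpose R0)"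
    by (simp add: assms rotation_matrix_mult rotation_matrix_transpose)
  then obtain \<alpha> \<beta> \<gamma> where "R1 ** transpose R0 = rot_z \<alpha> ** rot_x \<beta> ** rot_z \<gamma>"
    by (rule euler_angles)
  hence "R1 ** transpose R0 ** R0 = rot_z \<alpha> ** rot_x \<beta> ** rot_z \<gamma> ** R0"
    by simp
  hence R1: "R1 = rot_z \<alpha> ** rot_x \<beta> ** rot_z \<gamma> ** R0"
    using R0 by (simp add: rotation_matrix_def orthogonal_matrix_def flip: matrix_mul_assoc)
  \<comment> \<open>The turn to \<theta>1 contributes
    \<open>rot_z (- (?\<kappa> * (\<theta>1 - \<theta>)))\<close>, and the roll there has
    \<open>rot_z (- \<theta>1)\<close> as its right factor; \<theta>1 makes their product
    \<open>rot_z \<gamma>\<close>.\<close>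
  define \<theta>1 where "\<theta>1 = (?\<kappa> * \<theta> - \<gamma>) / (1 + ?\<kappa>)"
  have "1 + ?\<kappa> > 0" using pos by (simp add: add_pos_pos)
  hence "(1 + ?\<kappa>) * \<theta>1 = ?\<kappa> * \<theta> - \<gamma>"
    unfolding \<theta>1_def by simp
  hence \<theta>1: "- \<theta>1 + - (?\<kappa> * (\<theta>1 - \<theta>)) = \<gamma>"
    by (simp only: ring_distribs)
  let ?R = "rot_z (- (?\<kappa> * (\<theta>1 - \<theta>))) ** R0"
  let ?R' = "rodrigues (rolling_axis \<theta>1) \<beta> ** ?R"
  have R: "rotation_matrix ?R" "rotation_matrix ?R'"
    by (simp_all add: R0 rotation_matrix_mult rotation_matrix_rodrigues)
  have "?R' = rot_z \<theta>1 ** rot_x \<beta> ** (rot_z (- \<theta>1) ** rot_z (- (?\<kappa> * (\<theta>1 - \<theta>)))) ** R0"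
    by (subst rodrigues_rolling_axis) (simp add: matrix_mul_assoc)
  also have "\<dots> = rot_z \<theta>1 ** rot_x \<beta> ** rot_z \<gamma> ** R0"
    by (simp only: \<theta>1 flip: rodrigues_add[OF norm_coordinate_axes(2)])
  \<comment> \<open>The left factor \<open>rot_z \<theta>1\<close> of the roll still has to become
    \<open>rot_z \<alpha>\<close>.\<close>
  finally have "rot_z (\<alpha> - \<theta>1) ** ?R' = rot_z (\<alpha> - \<theta>1 + \<theta>1) ** rot_x \<beta> ** rot_z \<gamma> ** R0"
    by (simp only: matrix_mul_assoc rodrigues_add[OF norm_coordinate_axes(2)])
  hence R1': "rot_z (\<alpha> - \<theta>1) ** ?R' = R1"
    by (simp add: R1)
  \<comment> \<open>One maneuver supplies the missing vertical rotation and also makes up for the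
    displacement of the center by the roll.\<close>
  obtain \<theta>' where \<theta>': "steerable \<theta>1 ?R' (x + (r * (- \<beta>)) *\<^sub>R rolling_direction \<theta>1) \<theta>' R1 y"
    using steerable_turn_translate[OF R(2)] R1' by metis
  have "steerable \<theta> R0 x \<theta>1 ?R x"
    using steerable_turn[OF R0] .
  also have "steerable \<theta>1 ?R x \<theta>1 ?R' (x + (r * (- \<beta>)) *\<^sub>R rolling_direction \<theta>1)"
    using steerable_roll[OF R(1), of \<theta>1 x "- \<beta>"] by simp
  also note \<theta>'
  finally show ?thesis by (rule that)
qed

end

theorem theorem4p1:
  fixes r \<rho> w h Is J :: real
  assumes "r > 0" and "\<rho> > 0" and "w > 0" and "h > 0" and "Is > 0" and "J > 0"
  shows "fiber_controllable r \<rho> w h Is J"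
proof -
  interpret rolling_robot r \<rho> w h Is J
    using assms by unfold_locales
  show ?thesis
    unfolding fiber_controllable_def
  proof (intro ballI allI impI)
    fix g0 g1 :: "(real^3^3) \<times> (real^2)" and \<phi>0 :: "real^2" and t0 t1 :: real
    assume g: "g0 \<in> fiber" "g1 \<in> fiber" and t: "t0 < t1"
    have "rotation_matrix (fst g0)" "rotation_matrix (fst g1)"
      using g by (auto simp: fiber_def)
    then obtain \<theta>' where
      "steerable (heading \<phi>0) (fst g0) (snd g0) \<theta>' (fst g1) (snd g1)"
      by (rule steerable_fiber)
    from this[unfolded steerable_def, rule_format, OF refl t]
    obtain u \<phi> R x where "continuous_on {t0..t1} u"
      "robot_trajectory r \<rho> w h Is J t0 t1 u \<phi> R x" "\<phi> t0 = \<phi>0"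
      "R t0 = fst g0" "x t0 = snd g0" "R t1 = fst g1" "x t1 = snd g1"
      by blast
    thus "\<exists>u \<phi> R x. continuous_on {t0..t1} u \<and>
        robot_trajectory r \<rho> w h Is J t0 t1 u \<phi> R x \<and>
        \<phi> t0 = \<phi>0 \<and> (R t0, x t0) = g0 \<and> (R t1, x t1) = g1"
      by (intro exI[of _ u] exI[of _ \<phi>] exI[of _ R] exI[of _ x]) simp
  qed
qed

end
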